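(* Let $G$ be a group and let $X,Y$ be compact $G$-metric spaces belonging to the class $\mathcal H^G$, with associated constants $r^G(X),r^G(Y)>0$. If $$d_{\mathrm{HT}}^G\big((\mathcal P_{\mathrm{fin}}(X),\mathrm{diam}_\infty^X),(\mathcal P_{\mathrm{fin}}(Y),\mathrm{diam}_\infty^Y)\big)<\tfrac12\min\{r^G(X),r^G(Y)\},$$ then $X$ and $Y$ are $G$-homotopy equivalent.
   Context: "Map" means continuous function. A $G$-metric space is a (nonempty) metric space $(X,d_X)$ with a left action $\alpha_X$ of $G$ by isometries. A $G$-map is a continuous $G$-equivariant function. $G$-maps $\varphi,\varphi':X\to Y$ are $G$-homotopic if there is a continuous $H:X\times[0,1]\to Y$ with $H(\cdot,0)=\varphi$, $H(\cdot,1)=\varphi'$ and every $H(\cdot,t)$ a $G$-map. $G$-maps $\varphi:X\to Y$ and $\psi:Y\to X$ are mutually $G$-homotopy inverse $G$-homotopy equivalences if $\psi\circ\varphi$ and $\varphi\circ\psi$ are $G$-homotopic to the identities; then $X,Y$ are $G$-homotopy equivalent. $\mathcal P_{\mathrm{fin}}(X)$ is the set of finitely supported Borel probability measures on $X$ with the weak topology and the push-forward $G$-action; $\mathrm{diam}_\infty^X(\mu)$ is the diameter of the support of $\mu$; for $r>0$, $\mathrm{VR}^{\mathrm m}_\infty(X;r):=\{\mu\in\mathcal P_{\mathrm{fin}}(X):\mathrm{diam}_\infty^X(\mu)<r\}$ with the subspace topology and $G$-action. $d_{\mathrm{HT}}^G$: consider triples $(Z,\alpha_Z,\beta_Z)$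 with $Z$ a topological space, $\alpha_Z$ a $G$-action by homeomorphisms, $\beta_Z:Z\to\mathbb R$ a $G$-invariant function. For $\delta\ge0$ a $(G,\delta)$-map $\Phi:Z\to W$ is a $G$-map with $\beta_W(\Phi(z))\le\beta_Z(z)+\delta$ for all $z$; two $(G,\delta)$-maps are $(G,\delta)$-homotopic if joined by a continuous homotopy $H:Z\times[0,1]\to W$ with every $H(\cdot,t)$ a $(G,\delta)$-map. $Z,W$ are $(G,\delta)$-homotopy equivalent if there are $(G,\delta)$-maps $\Phi:Z\to W$, $\Psi:W\to Z$ with $\Psi\circ\Phi$ and $\Phi\circ\Psi$ $(G,2\delta)$-homotopic to the respective identities. $d_{\mathrm{HT}}^G(Z,W)$ is the infimum of such $\delta\ge0$ ($+\infty$ if there are none). Class $\mathcal H^G$: all compact $G$-metric spaces $X$ for which there exists $r^G(X)>0$ such that: (1) for each $\varepsilon\in(0,r^G(X)]$ there is a $G$-homotopy equivalence $p_\varepsilon^X:\mathrm{VR}^{\mathrm m}_\infty(X;\varepsilon)\to X$ that has the embedding $j_\varepsilon^X:X\to\mathrm{VR}^{\mathrm m}_\infty(X;\varepsilon)$, $x\mapsto\delta_x$ (Dirac measure), as a $G$-homotopy inverse; (2) for all $0<\varepsilon\le\varepsilon'\le r^G(X)$, $p_{\varepsilon'}^X\circ\iota^X_{\varepsilon,\varepsilon'}$ is $G$-homotopic to $p_\varepsilon^X$, where $\iota^X_{\varepsilon,\varepsilon'}:\mathrm{VR}^{\mathrm m}_\infty(X;\varepsilon)\hookrightarrow\mathrm{VR}^{\mathrm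 m}_\infty(X;\varepsilon')$ is the inclusion. *)

theory Defs
  imports "HOL-Probability.Probability" "HOL-Algebra.Group_Action"
begin

subsection \<open>\<open>G\<close>-spaces, \<open>G\<close>-maps and \<open>G\<close>-homotopy\<close>

text \<open>
  A \<open>G\<close>-space is a topology \<open>T\<close> on an arbitrary carrier \<open>topspace T\<close>, with an action given as a
  curried function \<open>a\<close>. Values of \<open>a g\<close> and of maps outside the carrier are irrelevant; the
  restriction is needed because \<^const>\<open>group_action\<close> asks for extensional functions.
\<close>

definition G_space :: "('g, 'm) monoid_scheme \<Rightarrow> 'z topology \<Rightarrow> ('g \<Rightarrow> 'z \<Rightarrow> 'z) \<Rightarrow> bool" where
  "G_space G T a \<longleftrightarrow>
     group_action G (topspace T) (\<lambda>g. restrict (a g) (topspace T)) \<and>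
     (\<forall>g\<in>carrier G. homeomorphic_map T T (a g))"

text \<open>
  A metric space is represented by a whole type of class \<^class>\<open>metric_space\<close>, which is
  automatically nonempty; as a topological space it is \<open>euclidean\<close>, the topology of the class.
\<close>

definition G_metric_space ::
    "('g, 'm) monoid_scheme \<Rightarrow> ('g \<Rightarrow> 'a::metric_space \<Rightarrow> 'a) \<Rightarrow> bool" where
  "G_metric_space G \<alpha> \<longleftrightarrow>
     group_action G UNIV \<alpha> \<and> (\<forall>g\<in>carrier G. \<forall>x y. dist (\<alpha> g x) (\<alpha> g y) = dist x y)"

definition G_map ::
    "('g, 'm) monoid_scheme \<Rightarrow> 'z topology \<Rightarrow> ('g \<Rightarrow> 'z \<Rightarrow> 'z) \<Rightarrow>
     'w topology \<Rightarrow> ('g \<Rightarrow> 'w \<Rightarrow> 'w) \<Rightarrow> ('z \<Rightarrow> 'w) \<Rightarrow> bool" where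
  "G_map G T a S b f \<longleftrightarrow>
     continuous_map T S f \<and> (\<forall>g\<in>carrier G. \<forall>z\<in>topspace T. f (a g z) = b g (f z))"

definition G_homotopic ::
    "('g, 'm) monoid_scheme \<Rightarrow> 'z topology \<Rightarrow> ('g \<Rightarrow> 'z \<Rightarrow> 'z) \<Rightarrow>
     'w topology \<Rightarrow> ('g \<Rightarrow> 'w \<Rightarrow> 'w) \<Rightarrow> ('z \<Rightarrow> 'w) \<Rightarrow> ('z \<Rightarrow> 'w) \<Rightarrow> bool" where
  "G_homotopic G T a S b = homotopic_with (G_map G T a S b) T S"

definition G_homotopy_inverses ::
    "('g, 'm) monoid_scheme \<Rightarrow> 'z topology \<Rightarrow> ('g \<Rightarrow> 'z \<Rightarrow> 'z) \<Rightarrow>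
     'w topology \<Rightarrow> ('g \<Rightarrow> 'w \<Rightarrow> 'w) \<Rightarrow> ('z \<Rightarrow> 'w) \<Rightarrow> ('w \<Rightarrow> 'z) \<Rightarrow> bool" where
  "G_homotopy_inverses G T a S b \<phi> \<psi> \<longleftrightarrow>
     G_map G T a S b \<phi> \<and> G_map G S b T a \<psi> \<and>
     G_homotopic G T a T a (\<psi> \<circ> \<phi>) id \<and> G_homotopic G S b S b (\<phi> \<circ> \<psi>) id"

definition G_homotopy_equivalent ::
    "('g, 'm) monoid_scheme \<Rightarrow> 'z topology \<Rightarrow> ('g \<Rightarrow> 'z \<Rightarrow> 'z) \<Rightarrow>
     'w topology \<Rightarrow> ('g \<Rightarrow> 'w \<Rightarrow> 'w) \<Rightarrow> bool" where
  "G_homotopy_equivalent G T a S b \<longleftrightarrow> (\<exists>\<phi> \<psi>. G_homotopy_inverses G T a S b \<phi> \<psi>)"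


subsection \<open>The distance \<open>d\<^sub>H\<^sub>T\<close>\<close>

text \<open>
  The objects compared by \<open>d_HT\<close> are triples \<open>(T, a, \<beta>)\<close> satisfying \<open>valued_G_space\<close>; they are
  passed as three consecutive arguments. No continuity is required of \<open>\<beta>\<close>.
\<close>

definition valued_G_space ::
    "('g, 'm) monoid_scheme \<Rightarrow> 'z topology \<Rightarrow> ('g \<Rightarrow> 'z \<Rightarrow> 'z) \<Rightarrow> ('z \<Rightarrow> real) \<Rightarrow> bool" where
  "valued_G_space G T a \<beta> \<longleftrightarrow>
     G_space G T a \<and> (\<forall>g\<in>carrier G. \<forall>z\<in>topspace T. \<beta> (a g z) = \<beta> z)"

definition G_delta_map ::
    "('g, 'm) monoid_scheme \<Rightarrow> real \<Rightarrow> 'z topology \<Rightarrow> ('g \<Rightarrow> 'z \<Rightarrow> 'z) \<Rightarrow> ('z \<Rightarrow> real) \<Rightarrow>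
     'w topology \<Rightarrow> ('g \<Rightarrow> 'w \<Rightarrow> 'w) \<Rightarrow> ('w \<Rightarrow> real) \<Rightarrow> ('z \<Rightarrow> 'w) \<Rightarrow> bool" where
  "G_delta_map G \<delta> T a \<beta> S b \<gamma> f \<longleftrightarrow>
     G_map G T a S b f \<and> (\<forall>z\<in>topspace T. \<gamma> (f z) \<le> \<beta> z + \<delta>)"

definition G_delta_homotopic ::
    "('g, 'm) monoid_scheme \<Rightarrow> real \<Rightarrow> 'z topology \<Rightarrow> ('g \<Rightarrow> 'z \<Rightarrow> 'z) \<Rightarrow> ('z \<Rightarrow> real) \<Rightarrow>
     'w topology \<Rightarrow> ('g \<Rightarrow> 'w \<Rightarrow> 'w) \<Rightarrow> ('w \<Rightarrow> real) \<Rightarrow> ('z \<Rightarrow> 'w) \<Rightarrow> ('z \<Rightarrow> 'w) \<Rightarrow> bool" where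
  "G_delta_homotopic G \<delta> T a \<beta> S b \<gamma> = homotopic_with (G_delta_map G \<delta> T a \<beta> S b \<gamma>) T S"

definition G_delta_homotopy_equivalent ::
    "('g, 'm) monoid_scheme \<Rightarrow> real \<Rightarrow> 'z topology \<Rightarrow> ('g \<Rightarrow> 'z \<Rightarrow> 'z) \<Rightarrow> ('z \<Rightarrow> real) \<Rightarrow>
     'w topology \<Rightarrow> ('g \<Rightarrow> 'w \<Rightarrow> 'w) \<Rightarrow> ('w \<Rightarrow> real) \<Rightarrow> bool" where
  "G_delta_homotopy_equivalent G \<delta> T a \<beta> S b \<gamma> \<longleftrightarrow>
     (\<exists>\<Phi> \<Psi>. G_delta_map G \<delta> T a \<beta> S b \<gamma> \<Phi> \<and> G_delta_map G \<delta> S b \<gamma> T a \<beta> \<Psi> \<and>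
        G_delta_homotopic G (2 * \<delta>) T a \<beta> T a \<beta> (\<Psi> \<circ> \<Phi>) id \<and>
        G_delta_homotopic G (2 * \<delta>) S b \<gamma> S b \<gamma> (\<Phi> \<circ> \<Psi>) id)"

definition d_HT ::
    "('g, 'm) monoid_scheme \<Rightarrow> 'z topology \<Rightarrow> ('g \<Rightarrow> 'z \<Rightarrow> 'z) \<Rightarrow> ('z \<Rightarrow> real) \<Rightarrow>
     'w topology \<Rightarrow> ('g \<Rightarrow> 'w \<Rightarrow> 'w) \<Rightarrow> ('w \<Rightarrow> real) \<Rightarrow> ereal" where
  "d_HT G T a \<beta> S b \<gamma> =
     Inf {ereal \<delta> | \<delta>. 0 \<le> \<delta> \<and> G_delta_homotopy_equivalent G \<delta> T a \<beta> S b \<gamma>}"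


subsection \<open>Finitely supported measures and the metric Vietoris--Rips thickening\<close>

definition measure_support :: "'a::topological_space measure \<Rightarrow> 'a set" where
  "measure_support \<mu> = {x. \<forall>U. open U \<and> x \<in> U \<longrightarrow> emeasure \<mu> U > 0}"

text \<open>
  The last condition is automatic on second countable spaces, but not in general: without it a
  measure with empty support could qualify.
\<close>

definition P_fin :: "'a::metric_space measure set" where
  "P_fin = {\<mu>. prob_space \<mu> \<and> sets \<mu> = sets borel \<and>
               finite (measure_support \<mu>) \<and> emeasure \<mu> (measure_support \<mu>) = 1}"

text \<open>The coarsest topology making integration of each bounded continuous function continuous.\<close>

definition weak_topology :: "'a::metric_space measure topology" where
  "weak_topology = topology_generated_by
     {{\<mu> \<in> P_fin. (\<integral>x. apply_bcontfun f x \<partial>\<mu>) \<in> U} | (f :: 'a \<Rightarrow>\<^sub>C real) U. open U}"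

definition pushforward :: "('g \<Rightarrow> 'a \<Rightarrow> 'a) \<Rightarrow> 'g \<Rightarrow> 'a::metric_space measure \<Rightarrow> 'a measure" where
  "pushforward \<alpha> g \<mu> = distr \<mu> borel (\<alpha> g)"

definition diam_infty :: "'a::metric_space measure \<Rightarrow> real" where
  "diam_infty \<mu> = diameter (measure_support \<mu>)"

definition VR_infty :: "real \<Rightarrow> 'a::metric_space measure topology" where
  "VR_infty r = subtopology weak_topology {\<mu> \<in> P_fin. diam_infty \<mu> < r}"


lemma topspace_weak_topology: "topspace (weak_topology :: 'a::metric_space measure topology) = P_fin"
proof -
  have "(P_fin :: 'a measure set) \<in>
      {{\<mu> \<in> P_fin. (\<integral>x. apply_bcontfun f x \<partial>\<mu>) \<in> U} | (f :: 'a \<Rightarrow>\<^sub>C real) U. open U}"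
    by (intro CollectI exI[of _ "0 :: 'a \<Rightarrow>\<^sub>C real"] exI[of _ "UNIV :: real set"]) auto
  then show ?thesis
    unfolding weak_topology_def by auto
qed

lemma measure_support_return: "measure_support (return borel x) = {x :: 'a::metric_space}"
proof -
  have "y = x" if "\<forall>U. open U \<and> y \<in> U \<longrightarrow> emeasure (return borel x) U > 0" for y
    using that[rule_format, of "- {x}"] by (auto simp: open_Compl indicator_def split: if_splits)
  then show ?thesis
    by (auto simp: measure_support_def)
qed

lemma return_P_fin: "return borel (x :: 'a::metric_space) \<in> P_fin"
  by (auto simp: P_fin_def measure_support_return intro: prob_space_return)

lemma diam_infty_return: "diam_infty (return borel (x :: 'a::metric_space)) = 0"
  by (simp add: diam_infty_def measure_support_return)

lemma G_metric_space_action: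
  assumes "G_metric_space G \<alpha>" and g: "g \<in> carrier G"
  shows "continuous_on UNIV (\<alpha> g)" and "bij (\<alpha> g)"
    and "dist (\<alpha> g x) (\<alpha> g y) = dist x y"
    and "\<alpha> (inv\<^bsub>G\<^esub> g) (\<alpha> g x) = x" and "\<alpha> g (\<alpha> (inv\<^bsub>G\<^esub> g) x) = x"
    and "inv\<^bsub>G\<^esub> g \<in> carrier G" and "g' \<in> carrier G \<Longrightarrow> \<alpha> (g \<otimes>\<^bsub>G\<^esub> g') x = \<alpha> g (\<alpha> g' x)"
proof -
  interpret group_action G UNIV \<alpha> using assms by (simp add: G_metric_space_def)
  interpret group G using group_hom by (simp add: group_hom_def)
  show d: "dist (\<alpha> g x) (\<alpha> g y) = dist x y" for x y
    using assms by (simp add: G_metric_space_def)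
  show "continuous_on UNIV (\<alpha> g)"
    unfolding continuous_on_iff using d by auto
  show "bij (\<alpha> g)" using bij_prop0[OF g] by (simp add: Bij_def)
  show i: "inv\<^bsub>G\<^esub> g \<in> carrier G" using g by simp
  show m: "\<alpha> (g \<otimes>\<^bsub>G\<^esub> g') x = \<alpha> g (\<alpha> g' x)" if "g' \<in> carrier G" for g' x
    using composition_rule[of x g g'] g that by simp
  show "\<alpha> (inv\<^bsub>G\<^esub> g) (\<alpha> g x) = x"
    using orbit_sym_aux[OF g, of x "\<alpha> g x"] by simp
  show "\<alpha> g (\<alpha> (inv\<^bsub>G\<^esub> g) x) = x"
    using m[OF i, of x] g id_eq_one by (metis UNIV_I r_inv restrict_apply')
qed

lemma measure_support_pushforward:
  assumes G: "G_metric_space G \<alpha>" and g: "g \<in> carrier G" and s: "sets \<mu> = sets borel"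
  shows "measure_support (pushforward \<alpha> g \<mu>) = \<alpha> g ` measure_support \<mu>"
proof -
  note act = G_metric_space_action[OF G]
  have meas: "\<alpha> g \<in> \<mu> \<rightarrow>\<^sub>M borel"
    using borel_measurable_continuous_onI[OF act(1)[OF g]] s measurable_cong_sets by blast
  have em: "emeasure (pushforward \<alpha> g \<mu>) U = emeasure \<mu> (\<alpha> g -` U)" if "open U" for U
    using that meas s sets_eq_imp_space_eq[OF s]
    by (simp add: pushforward_def emeasure_distr)
  have op: "open (\<alpha> h -` U)" if "open U" "h \<in> carrier G" for U h
    using act(1)[OF that(2)] that(1) by (simp add: open_vimage)
  have "y \<in> measure_support (pushforward \<alpha> g \<mu>) \<longleftrightarrow> \<alpha> (inv\<^bsub>G\<^esub> g) y \<in> measure_support \<mu>" for y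
  proof
    assume y: "y \<in> measure_support (pushforward \<alpha> g \<mu>)"
    show "\<alpha> (inv\<^bsub>G\<^esub> g) y \<in> measure_support \<mu>"
      unfolding measure_support_def
    proof (intro CollectI allI impI)
      fix U assume U: "open U \<and> \<alpha> (inv\<^bsub>G\<^esub> g) y \<in> U"
      let ?V = "\<alpha> (inv\<^bsub>G\<^esub> g) -` U"
      have "open ?V" "y \<in> ?V" using op U act(6)[OF g] by auto
      then have "emeasure (pushforward \<alpha> g \<mu>) ?V > 0"
        using y by (simp add: measure_support_def)
      moreover have "\<alpha> g -` ?V = U" using act(4)[OF g] by auto
      ultimately show "emeasure \<mu> U > 0" using em[OF \<open>open ?V\<close>] by simp
    qed
  next
    assume y: "\<alpha> (inv\<^bsub>G\<^esub> g) y \<in> measure_support \<mu>"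
    show "y \<in> measure_support (pushforward \<alpha> g \<mu>)"
      unfolding measure_support_def
    proof (intro CollectI allI impI)
      fix U assume U: "open U \<and> y \<in> U"
      then have "open (\<alpha> g -` U)" "\<alpha> (inv\<^bsub>G\<^esub> g) y \<in> \<alpha> g -` U"
        using op g act(5)[OF g] by auto
      then show "emeasure (pushforward \<alpha> g \<mu>) U > 0"
        using y em U by (simp add: measure_support_def)
    qed
  qed
  then show ?thesis
    using act(4)[OF g] act(5)[OF g] by (auto simp: image_iff) metis
qed

lemma diam_infty_pushforward:
  assumes "G_metric_space G \<alpha>" and "g \<in> carrier G" and "sets \<mu> = sets borel"
  shows "diam_infty (pushforward \<alpha> g \<mu>) = diam_infty \<mu>"
proof -
  have "(\<lambda>(x, y). dist x y) ` (\<alpha> g ` S \<times> \<alpha> g ` S) = (\<lambda>(x, y). dist x y) ` (S \<times> S)" for S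
    using G_metric_space_action(3)[OF assms(1,2)] by (force simp: image_iff)
  then show ?thesis
    unfolding diam_infty_def measure_support_pushforward[OF assms] diameter_def
    by (simp add: case_prod_beta')
qed

lemma pushforward_P_fin:
  assumes G: "G_metric_space G \<alpha>" and g: "g \<in> carrier G" and \<mu>: "\<mu> \<in> P_fin"
  shows "pushforward \<alpha> g \<mu> \<in> P_fin"
proof -
  note act = G_metric_space_action[OF G]
  have s: "sets \<mu> = sets borel" and p: "prob_space \<mu>" and f: "finite (measure_support \<mu>)"
    and e: "emeasure \<mu> (measure_support \<mu>) = 1" using \<mu> by (auto simp: P_fin_def)
  have meas: "\<alpha> g \<in> \<mu> \<rightarrow>\<^sub>M borel"
    using borel_measurable_continuous_onI[OF act(1)[OF g]] s measurable_cong_sets by blast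
  have supp: "measure_support (pushforward \<alpha> g \<mu>) = \<alpha> g ` measure_support \<mu>"
    by (rule measure_support_pushforward[OF G g s])
  have "closed (\<alpha> g ` measure_support \<mu>)" using f by (simp add: finite_imp_closed)
  then have "emeasure (pushforward \<alpha> g \<mu>) (\<alpha> g ` measure_support \<mu>)
      = emeasure \<mu> (\<alpha> g -` \<alpha> g ` measure_support \<mu>)"
    using meas sets_eq_imp_space_eq[OF s] by (simp add: pushforward_def emeasure_distr)
  also have "\<alpha> g -` \<alpha> g ` measure_support \<mu> = measure_support \<mu>"
    using act(2)[OF g] by (simp add: bij_is_inj inj_vimage_image_eq)
  finally show ?thesis
    using p f e prob_space.prob_space_distr[OF p meas]
    by (simp add: P_fin_def supp) (simp add: pushforward_def)
qed

lemma continuous_map_pushforward: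
  fixes \<alpha> :: "'g \<Rightarrow> 'a::metric_space \<Rightarrow> 'a"
  assumes G: "G_metric_space G \<alpha>" and g: "g \<in> carrier G"
  shows "continuous_map weak_topology weak_topology (pushforward \<alpha> g)"
proof -
  let ?S = "{{\<mu> \<in> P_fin. (\<integral>x. apply_bcontfun f x \<partial>\<mu>) \<in> U} | (f :: 'a \<Rightarrow>\<^sub>C real) U. open U}"
  have *: "openin weak_topology (pushforward \<alpha> g -` B \<inter> topspace weak_topology)"
    if "B \<in> ?S" for B
  proof -
    from that obtain f :: "'a \<Rightarrow>\<^sub>C real" and U where
      B: "B = {\<mu> \<in> P_fin. (\<integral>x. apply_bcontfun f x \<partial>\<mu>) \<in> U}" and U: "open U" by blast
    have cont: "continuous_on UNIV (\<alpha> g)" by (rule G_metric_space_action(1)[OF G g])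
    define f' where "f' = Bcontfun (\<lambda>x. apply_bcontfun f (\<alpha> g x))"
    have "(\<lambda>x. apply_bcontfun f (\<alpha> g x)) \<in> bcontfun"
      unfolding bcontfun_def
      using cont continuous_on_compose2[OF continuous_on_apply_bcontfun[of UNIV f] cont]
        bounded_subset[OF bounded_apply_bcontfun[of f], of "range (\<lambda>x. apply_bcontfun f (\<alpha> g x))"]
      by auto
    then have f': "apply_bcontfun f' = (\<lambda>x. apply_bcontfun f (\<alpha> g x))"
      by (simp add: f'_def Bcontfun_inverse)
    have "pushforward \<alpha> g -` B \<inter> topspace weak_topology
        = {\<mu> \<in> P_fin. (\<integral>x. apply_bcontfun f' x \<partial>\<mu>) \<in> U}"
    proof -
      have "(\<integral>x. apply_bcontfun f x \<partial>pushforward \<alpha> g \<mu>) = (\<integral>x. apply_bcontfun f' x \<partial>\<mu>)"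
        if "\<mu> \<in> P_fin" for \<mu>
      proof -
        have "sets \<mu> = sets borel" using that by (simp add: P_fin_def)
        then have "\<alpha> g \<in> \<mu> \<rightarrow>\<^sub>M borel"
          using borel_measurable_continuous_onI[OF cont] measurable_cong_sets by blast
        moreover have "apply_bcontfun f \<in> borel_measurable borel"
          by (intro borel_measurable_continuous_onI) auto
        ultimately show ?thesis
          by (simp add: pushforward_def integral_distr f')
      qed
      then show ?thesis
        using pushforward_P_fin[OF G g] by (auto simp: B topspace_weak_topology)
    qed
    also have "openin weak_topology \<dots>"
      unfolding weak_topology_def using U by (intro topology_generated_by_Basis) blast
    finally show ?thesis .
  qed
  have "pushforward \<alpha> g ` topspace weak_topology \<subseteq> \<Union> ?S"
    using pushforward_P_fin[OF G g] topspace_weak_topology[where 'a = 'a]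
    unfolding weak_topology_def by auto
  with * show ?thesis
    unfolding continuous_on_generated_topo_iff[of weak_topology ?S, folded weak_topology_def] by blast
qed

lemma valued_G_space_P_fin:
  assumes G: "G_metric_space G \<alpha>"
  shows "valued_G_space G weak_topology (pushforward \<alpha>) diam_infty"
proof -
  interpret A: group_action G UNIV \<alpha> using assms by (simp add: G_metric_space_def)
  interpret group G using A.group_hom by (simp add: group_hom_def)
  note act = G_metric_space_action[OF G]
  have push_mult: "pushforward \<alpha> g (pushforward \<alpha> h \<mu>) = pushforward \<alpha> (g \<otimes>\<^bsub>G\<^esub> h) \<mu>"
    if "g \<in> carrier G" "h \<in> carrier G" "\<mu> \<in> P_fin" for g h \<mu>
  proof -
    have "sets \<mu> = sets borel" using that by (simp add: P_fin_def)
    then have "\<alpha> h \<in> \<mu> \<rightarrow>\<^sub>M borel"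
      using borel_measurable_continuous_onI[OF act(1)[OF that(2)]] measurable_cong_sets by blast
    moreover have "\<alpha> g \<in> borel \<rightarrow>\<^sub>M borel"
      using borel_measurable_continuous_onI[OF act(1)[OF that(1)]] .
    moreover have "\<alpha> (g \<otimes>\<^bsub>G\<^esub> h) = \<alpha> g \<circ> \<alpha> h" using act(7)[OF that(1,2)] by auto
    ultimately show ?thesis by (simp add: pushforward_def distr_distr)
  qed
  have push_one: "pushforward \<alpha> \<one>\<^bsub>G\<^esub> \<mu> = \<mu>" if "\<mu> \<in> P_fin" for \<mu>
  proof -
    have s: "sets \<mu> = sets borel" using that by (simp add: P_fin_def)
    have "\<alpha> \<one>\<^bsub>G\<^esub> = (\<lambda>x. x)" using A.id_eq_one by (simp add: fun_eq_iff)
    then show ?thesis using s by (simp add: pushforward_def distr_id2)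
  qed
  have push_inv: "pushforward \<alpha> (inv\<^bsub>G\<^esub> g) (pushforward \<alpha> g \<mu>) = \<mu>"
      "pushforward \<alpha> g (pushforward \<alpha> (inv\<^bsub>G\<^esub> g) \<mu>) = \<mu>"
    if "g \<in> carrier G" "\<mu> \<in> P_fin" for g \<mu>
    using that push_mult push_one by simp_all
  have homeo: "homeomorphic_map weak_topology weak_topology (pushforward \<alpha> g)"
    if g: "g \<in> carrier G" for g
    using g push_inv continuous_map_pushforward[OF G]
    by (intro homeomorphic_maps_imp_map[of _ _ _ "pushforward \<alpha> (inv\<^bsub>G\<^esub> g)"])
       (simp add: homeomorphic_maps_def topspace_weak_topology)
  have bij: "bij_betw (pushforward \<alpha> g) P_fin P_fin" if "g \<in> carrier G" for g
    using homeomorphic_map_maps homeo[OF that]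
    by (metis bij_betw_def homeomorphic_eq_everything_map topspace_weak_topology)
  have "group_action G P_fin (\<lambda>g. restrict (pushforward \<alpha> g) P_fin)"
  proof -
    have "(\<lambda>g. restrict (pushforward \<alpha> g) P_fin) \<in> hom G (BijGroup P_fin)"
    proof (rule homI)
      show R: "restrict (pushforward \<alpha> g) P_fin \<in> carrier (BijGroup P_fin)"
        if "g \<in> carrier G" for g
        using bij[OF that] by (simp add: BijGroup_def Bij_def)
      fix g h assume gh: "g \<in> carrier G" "h \<in> carrier G"
      show "restrict (pushforward \<alpha> (g \<otimes>\<^bsub>G\<^esub> h)) P_fin
          = restrict (pushforward \<alpha> g) P_fin \<otimes>\<^bsub>BijGroup P_fin\<^esub> restrict (pushforward \<alpha> h) P_fin"
        using R[OF gh(1)] R[OF gh(2)] push_mult[OF gh] pushforward_P_fin[OF G gh(2)]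
        by (auto simp: BijGroup_def compose_def fun_eq_iff)
    qed
    then show ?thesis
      using group_BijGroup is_group
      by (simp add: group_action_def group_hom_def group_hom_axioms_def)
  qed
  then show ?thesis
    unfolding valued_G_space_def G_space_def
    using homeo diam_infty_pushforward[OF G] by (auto simp: topspace_weak_topology P_fin_def)
qed


subsection \<open>The class \<open>\<H>\<^sup>G\<close>\<close>

text \<open>
  \<open>class_H G \<alpha> r\<close>: the metric space given by the type, with action \<open>\<alpha>\<close>, belongs to the class, with
  associated constant \<open>r\<close>. The inclusion of \<open>VR_infty \<epsilon>\<close> into \<open>VR_infty \<epsilon>'\<close> is \<open>id\<close>.
\<close>

definition class_H ::
    "('g, 'm) monoid_scheme \<Rightarrow> ('g \<Rightarrow> 'a::metric_space \<Rightarrow> 'a) \<Rightarrow> real \<Rightarrow> bool" where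
  "class_H G \<alpha> r \<longleftrightarrow>
     compact (UNIV :: 'a set) \<and> G_metric_space G \<alpha> \<and> 0 < r \<and>
     (\<exists>p :: real \<Rightarrow> 'a measure \<Rightarrow> 'a.
        (\<forall>\<epsilon>. 0 < \<epsilon> \<and> \<epsilon> \<le> r \<longrightarrow>
           G_homotopy_inverses G (VR_infty \<epsilon>) (pushforward \<alpha>) euclidean \<alpha>
             (p \<epsilon>) (\<lambda>x. return borel x)) \<and>
        (\<forall>\<epsilon> \<epsilon>'. 0 < \<epsilon> \<and> \<epsilon> \<le> \<epsilon>' \<and> \<epsilon>' \<le> r \<longrightarrow>
           G_homotopic G (VR_infty \<epsilon>) (pushforward \<alpha>) euclidean \<alpha> (p \<epsilon>' \<circ> id) (p \<epsilon>)))"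

end

theory Submission
  imports Defs
begin

text \<open>
  Fix \<open>\<delta>\<close> with \<open>2\<delta> < min rX rY\<close> and \<open>(G,\<delta>)\<close>-maps \<open>\<Phi>\<close>, \<open>\<Psi>\<close> between the spaces of measures on \<open>X\<close>
  and \<open>Y\<close> that are inverse up to \<open>(G,2\<delta>)\<close>-homotopy, and choose \<open>\<epsilon> > 0\<close> with
  \<open>\<epsilon> + 2\<delta> \<le> min rX rY\<close>. A \<open>(G,\<delta>)\<close>-map sends measures of diameter less than \<open>s\<close> to measures of
  diameter less than \<open>s + \<delta>\<close>, so it restricts to a \<open>G\<close>-map of Vietoris--Rips thickenings whose scales
  differ by \<open>\<delta>\<close>. Dirac measures have diameter zero, and \<open>\<epsilon> + \<delta>\<close> is a scale at which the thickening
  of either space still collapses onto the space. This gives the candidates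
  \<open>f : X \<rightarrow> VR(X;\<epsilon>) \<rightarrow> VR(Y;\<epsilon>+\<delta>) \<rightarrow> Y\<close> and \<open>g : Y \<rightarrow> VR(Y;\<epsilon>) \<rightarrow> VR(X;\<epsilon>+\<delta>) \<rightarrow> X\<close>,
  in which the outer arrows are the Dirac embedding \<open>j\<close> and the collapse \<open>p\<close>, and the middle ones
  are \<open>\<Phi>\<close> and \<open>\<Psi>\<close>.

  In \<open>g \<circ> f = p \<circ> \<Psi> \<circ> j \<circ> p \<circ> \<Phi> \<circ> j\<close> the inner \<open>j \<circ> p\<close> is homotopic to the identity of
  \<open>VR(Y;\<epsilon>+\<delta>)\<close>. To use this, the target of \<open>\<Psi>\<close> must be enlarged to \<open>VR(X;\<epsilon>+2\<delta>)\<close>, and the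
  compatibility of the collapses at different scales permits it. What remains is \<open>p \<circ> \<Psi> \<circ> \<Phi> \<circ> j\<close>
  at scale \<open>\<epsilon> + 2\<delta>\<close>. Along the \<open>(G,2\<delta>)\<close>-homotopy from \<open>\<Psi> \<circ> \<Phi>\<close> to the identity a Dirac measure
  never reaches a diameter above \<open>2\<delta>\<close>, so the homotopy stays inside \<open>VR(X;\<epsilon>+2\<delta>)\<close>, and
  \<open>p \<circ> j\<close> is homotopic to the identity. This half of the argument is
  \<open>collapsed_roundtrip_homotopic_id\<close>; it is symmetric in \<open>X\<close> and \<open>Y\<close>.
\<close>

lemma G_map_compose:
  assumes f: "G_map G T a S b f" and h: "G_map G S b U c h"
  shows "G_map G T a U c (h \<circ> f)"
proof -
  have "f z \<in> topspace S" if "z \<in> topspace T" for z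
    using f that by (auto simp: G_map_def dest: continuous_map_image_subset_topspace)
  then show ?thesis
    using assms by (auto simp: G_map_def intro: continuous_map_compose)
qed

lemma G_homotopic_compose_left:
  assumes hom: "G_homotopic G T a S b f f'" and h: "G_map G S b U c h"
  shows "G_homotopic G T a U c (h \<circ> f) (h \<circ> f')"
  unfolding G_homotopic_def
proof (rule homotopic_with_compose_continuous_map_left)
  show "homotopic_with (G_map G T a S b) T S f f'"
    using hom by (simp add: G_homotopic_def)
  show "continuous_map S U h"
    using h by (simp add: G_map_def)
qed (rule G_map_compose[OF _ h])

lemma G_homotopic_compose_right:
  assumes hom: "G_homotopic G S b U c f f'" and h: "G_map G T a S b h"
  shows "G_homotopic G T a U c (f \<circ> h) (f' \<circ> h)"
  unfolding G_homotopic_def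
proof (rule homotopic_with_compose_continuous_map_right)
  show "homotopic_with (G_map G S b U c) S U f f'"
    using hom by (simp add: G_homotopic_def)
  show "continuous_map T S h"
    using h by (simp add: G_map_def)
qed (rule G_map_compose[OF h])

lemma G_homotopic_trans:
  assumes "G_homotopic G T a S b f f'" and "G_homotopic G T a S b f' f''"
  shows "G_homotopic G T a S b f f''"
  using assms unfolding G_homotopic_def by (rule homotopic_with_trans)

lemma G_homotopic_sym:
  assumes "G_homotopic G T a S b f f'"
  shows "G_homotopic G T a S b f' f"
  using assms unfolding G_homotopic_def by (simp add: homotopic_with_sym)

lemma homotopic_with_into_subtopology:
  assumes hom: "homotopic_with P T S f f'"
    and sub: "\<And>k. P k \<Longrightarrow> k ` topspace T \<subseteq> C"
    and Q: "\<And>k. P k \<Longrightarrow> Q k"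
  shows "homotopic_with Q T (subtopology S C) f f'"
proof -
  obtain h where h: "continuous_map (prod_topology (top_of_set {0..1::real}) T) S h"
      "\<forall>x. h (0, x) = f x" "\<forall>x. h (1, x) = f' x" "\<forall>t\<in>{0..1}. P (\<lambda>x. h (t, x))"
    using hom unfolding homotopic_with_def by blast
  have "h (t, x) \<in> C" if "t \<in> {0..1}" "x \<in> topspace T" for t x
    using sub[of "\<lambda>x. h (t, x)"] h(4) that by auto
  then have "continuous_map (prod_topology (top_of_set {0..1}) T) (subtopology S C) h"
    using h(1) by (auto simp: continuous_map_in_subtopology)
  then show ?thesis
    unfolding homotopic_with_def using h(2-4) Q by blast
qed

lemma topspace_VR_infty: "topspace (VR_infty s) = {\<mu> \<in> P_fin. diam_infty \<mu> < s}"
  by (auto simp: VR_infty_def topspace_weak_topology)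

lemma G_map_VR_infty_weaken:
  assumes "G_map G T a (VR_infty s) b f"
  shows "G_map G T a weak_topology b f"
  using assms by (auto simp: G_map_def VR_infty_def continuous_map_in_subtopology)

text \<open>
  This is where the additive distortion of the diameter meets the filtration by scale.
\<close>

lemma G_delta_map_VR_infty:
  assumes "G_delta_map G \<delta> weak_topology a diam_infty weak_topology b diam_infty \<Phi>"
  shows "G_map G (VR_infty s) a (VR_infty (s + \<delta>)) b \<Phi>"
proof -
  have \<Phi>: "continuous_map weak_topology weak_topology \<Phi>"
      "\<And>g \<mu>. g \<in> carrier G \<Longrightarrow> \<mu> \<in> P_fin \<Longrightarrow> \<Phi> (a g \<mu>) = b g (\<Phi> \<mu>)"
      "\<And>\<mu>. \<mu> \<in> P_fin \<Longrightarrow> diam_infty (\<Phi> \<mu>) \<le> diam_infty \<mu> + \<delta>"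
    using assms by (auto simp: G_delta_map_def G_map_def topspace_weak_topology)
  have P: "\<Phi> \<mu> \<in> P_fin" if "\<mu> \<in> P_fin" for \<mu>
    using continuous_map_image_subset_topspace[OF \<Phi>(1)] that
    by (auto simp: topspace_weak_topology)
  have "continuous_map (VR_infty s) (VR_infty (s + \<delta>)) \<Phi>"
    unfolding VR_infty_def
  proof (rule continuous_map_into_subtopology)
    show "continuous_map (subtopology weak_topology {\<mu> \<in> P_fin. diam_infty \<mu> < s})
        weak_topology \<Phi>"
      using \<Phi>(1) by (rule continuous_map_from_subtopology)
    show "\<Phi> \<in> topspace (subtopology weak_topology {\<mu> \<in> P_fin. diam_infty \<mu> < s})
        \<rightarrow> {\<mu> \<in> P_fin. diam_infty \<mu> < s + \<delta>}"
      using \<Phi>(3) P by (force simp: topspace_weak_topology)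
  qed
  then show ?thesis
    using \<Phi>(2) by (simp add: G_map_def topspace_VR_infty)
qed

text \<open>
  Only the values on Dirac measures matter for the homotopy, and these have diameter zero. Hence an
  additive bound \<open>\<delta>\<close> along the homotopy becomes an absolute bound, and any scale above \<open>\<delta>\<close> contains
  the whole track.
\<close>

lemma G_delta_homotopic_on_Diracs:
  fixes T :: "'a::metric_space topology"
  assumes hom: "G_delta_homotopic G \<delta> weak_topology a diam_infty weak_topology b diam_infty F F'"
    and j: "G_map G T c weak_topology a (\<lambda>x. return borel x)"
    and \<delta>: "\<delta> < s"
  shows "G_homotopic G T c (VR_infty s) b (F \<circ> (\<lambda>x. return borel x)) (F' \<circ> (\<lambda>x. return borel x))"
proof -
  let ?j = "\<lambda>x::'a. return borel x"
  let ?P = "\<lambda>k. G_map G T c weak_topology b k \<and>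
      k ` topspace T \<subseteq> {\<mu> \<in> P_fin. diam_infty \<mu> < s}"
  have P: "?P (k \<circ> ?j)"
    if k: "G_delta_map G \<delta> weak_topology a diam_infty weak_topology b diam_infty k" for k
  proof -
    have m: "G_map G T c weak_topology b (k \<circ> ?j)"
      using k by (intro G_map_compose[OF j]) (simp add: G_delta_map_def)
    moreover have "k (?j x) \<in> P_fin" if "x \<in> topspace T" for x
      using m that continuous_map_image_subset_topspace[of T weak_topology "k \<circ> ?j"]
      by (auto simp: G_map_def topspace_weak_topology)
    moreover have "diam_infty (k (?j x)) < s" for x
    proof -
      have "diam_infty (k (?j x)) \<le> diam_infty (?j x) + \<delta>"
        using k return_P_fin[of x] by (simp add: G_delta_map_def topspace_weak_topology)
      then show ?thesis
        using \<delta> by (simp add: diam_infty_return)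
    qed
    ultimately show ?thesis by auto
  qed
  have "homotopic_with ?P T weak_topology (F \<circ> ?j) (F' \<circ> ?j)"
  proof (rule homotopic_with_compose_continuous_map_right)
    show "homotopic_with (G_delta_map G \<delta> weak_topology a diam_infty weak_topology b diam_infty)
        weak_topology weak_topology F F'"
      using hom by (simp add: G_delta_homotopic_def)
    show "continuous_map T weak_topology ?j"
      using j by (simp add: G_map_def)
  qed (rule P)
  then have "homotopic_with (G_map G T c (VR_infty s) b) T
      (subtopology weak_topology {\<mu> \<in> P_fin. diam_infty \<mu> < s}) (F \<circ> ?j) (F' \<circ> ?j)"
    by (rule homotopic_with_into_subtopology)
      (auto simp: G_map_def VR_infty_def continuous_map_in_subtopology)
  then show ?thesis
    by (simp add: G_homotopic_def VR_infty_def)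
qed

text \<open>
  Here \<open>p\<close> and \<open>q\<close> are the collapses at scale \<open>\<epsilon> + \<delta>\<close> occurring in the two candidate maps. The
  collapse \<open>r\<close> at the larger scale \<open>\<epsilon> + 2\<delta>\<close> must replace \<open>q\<close>, because \<open>\<Psi>\<close> applied to a homotopy in
  \<open>VR(Y;\<epsilon>+\<delta>)\<close> is only known to stay in \<open>VR(X;\<epsilon>+2\<delta>)\<close>, where \<open>q\<close> need not be continuous.
\<close>

lemma collapsed_roundtrip_homotopic_id:
  fixes \<alpha> :: "'g \<Rightarrow> 'a::metric_space \<Rightarrow> 'a" and \<beta> :: "'g \<Rightarrow> 'b::metric_space \<Rightarrow> 'b"
    and q r :: "'a measure \<Rightarrow> 'a" and p :: "'b measure \<Rightarrow> 'b"
  assumes \<Phi>: "G_delta_map G \<delta> weak_topology (pushforward \<alpha>) diam_infty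
        weak_topology (pushforward \<beta>) diam_infty \<Phi>"
    and \<Psi>: "G_delta_map G \<delta> weak_topology (pushforward \<beta>) diam_infty
        weak_topology (pushforward \<alpha>) diam_infty \<Psi>"
    and \<Psi>\<Phi>: "G_delta_homotopic G (2 * \<delta>) weak_topology (pushforward \<alpha>) diam_infty
        weak_topology (pushforward \<alpha>) diam_infty (\<Psi> \<circ> \<Phi>) id"
    and \<epsilon>: "0 < \<epsilon>"
    and jX: "G_map G euclidean \<alpha> (VR_infty \<epsilon>) (pushforward \<alpha>) (\<lambda>x. return borel x)"
    and jY: "G_map G euclidean \<beta> (VR_infty \<epsilon>) (pushforward \<beta>) (\<lambda>x. return borel x)"
    and p: "G_homotopy_inverses G (VR_infty (\<epsilon> + \<delta>)) (pushforward \<beta>) euclidean \<beta> p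
        (\<lambda>x. return borel x)"
    and r: "G_homotopy_inverses G (VR_infty (\<epsilon> + 2 * \<delta>)) (pushforward \<alpha>) euclidean \<alpha> r
        (\<lambda>x. return borel x)"
    and qr: "G_homotopic G (VR_infty (\<epsilon> + \<delta>)) (pushforward \<alpha>) euclidean \<alpha> r q"
  shows "G_homotopic G euclidean \<alpha> euclidean \<alpha>
      ((q \<circ> \<Psi> \<circ> (\<lambda>x. return borel x)) \<circ> (p \<circ> \<Phi> \<circ> (\<lambda>x. return borel x))) id"
    (is "G_homotopic _ _ _ _ _ ((_ \<circ> _ \<circ> ?jY) \<circ> (_ \<circ> _ \<circ> ?jX)) _")
proof -
  have \<Phi>j: "G_map G euclidean \<alpha> (VR_infty (\<epsilon> + \<delta>)) (pushforward \<beta>) (\<Phi> \<circ> ?jX)"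
    using G_map_compose[OF jX G_delta_map_VR_infty[OF \<Phi>]] .
  have \<Psi>j: "G_map G euclidean \<beta> (VR_infty (\<epsilon> + \<delta>)) (pushforward \<alpha>) (\<Psi> \<circ> ?jY)"
    using G_map_compose[OF jY G_delta_map_VR_infty[OF \<Psi>]] .
  have pj: "G_map G euclidean \<alpha> euclidean \<beta> (p \<circ> (\<Phi> \<circ> ?jX))"
    using p by (intro G_map_compose[OF \<Phi>j]) (simp add: G_homotopy_inverses_def)
  have r_map: "G_map G (VR_infty (\<epsilon> + 2 * \<delta>)) (pushforward \<alpha>) euclidean \<alpha> r"
    and rj: "G_homotopic G euclidean \<alpha> euclidean \<alpha> (r \<circ> ?jX) id"
    and jp: "G_homotopic G (VR_infty (\<epsilon> + \<delta>)) (pushforward \<beta>) (VR_infty (\<epsilon> + \<delta>))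
      (pushforward \<beta>) (?jY \<circ> p) id"
    using p r by (simp_all add: G_homotopy_inverses_def)
  have \<Psi>': "G_map G (VR_infty (\<epsilon> + \<delta>)) (pushforward \<beta>) (VR_infty (\<epsilon> + 2 * \<delta>))
      (pushforward \<alpha>) \<Psi>"
    using G_delta_map_VR_infty[OF \<Psi>, of "\<epsilon> + \<delta>"] by (simp add: add.assoc)
  \<comment> \<open>Replacing \<open>q\<close> by \<open>r\<close> uses that \<open>\<Psi>\<close> sends Dirac measures into the smaller scale \<open>\<epsilon> + \<delta>\<close>.\<close>
  have 1: "G_homotopic G euclidean \<alpha> euclidean \<alpha>
      (q \<circ> (\<Psi> \<circ> ?jY) \<circ> (p \<circ> (\<Phi> \<circ> ?jX))) (r \<circ> (\<Psi> \<circ> ?jY) \<circ> (p \<circ> (\<Phi> \<circ> ?jX)))"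
    using G_homotopic_compose_right[OF G_homotopic_compose_right[OF G_homotopic_sym[OF qr] \<Psi>j] pj] .
  have 2: "G_homotopic G euclidean \<alpha> euclidean \<alpha>
      ((r \<circ> \<Psi>) \<circ> ((?jY \<circ> p) \<circ> (\<Phi> \<circ> ?jX))) ((r \<circ> \<Psi>) \<circ> (id \<circ> (\<Phi> \<circ> ?jX)))"
    using G_homotopic_compose_left[OF G_homotopic_compose_right[OF jp \<Phi>j] G_map_compose[OF \<Psi>' r_map]] .
  have "G_homotopic G euclidean \<alpha> (VR_infty (\<epsilon> + 2 * \<delta>)) (pushforward \<alpha>)
      ((\<Psi> \<circ> \<Phi>) \<circ> ?jX) (id \<circ> ?jX)"
    using G_delta_homotopic_on_Diracs[OF \<Psi>\<Phi> G_map_VR_infty_weaken[OF jX]] \<epsilon> by simp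
  note 3 = G_homotopic_compose_left[OF this r_map]
  show ?thesis
    using G_homotopic_trans[OF 1] 2 3 rj
    by (auto simp: comp_assoc intro: G_homotopic_trans)
qed

theorem theorem6:
  fixes G :: "('g, 'm) monoid_scheme"
    and \<alpha> :: "'g \<Rightarrow> 'a::metric_space \<Rightarrow> 'a"
    and \<beta> :: "'g \<Rightarrow> 'b::metric_space \<Rightarrow> 'b"
    and rX rY :: real
  assumes "group G"
    and "class_H G \<alpha> rX"
    and "class_H G \<beta> rY"
    and "d_HT G (weak_topology :: 'a measure topology) (pushforward \<alpha>) diam_infty
                (weak_topology :: 'b measure topology) (pushforward \<beta>) diam_infty
           < ereal (min rX rY / 2)"
  shows "G_homotopy_equivalent G (euclidean :: 'a topology) \<alpha> (euclidean :: 'b topology) \<beta>"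
proof -
  obtain p where p: "\<And>\<epsilon>. 0 < \<epsilon> \<Longrightarrow> \<epsilon> \<le> rX \<Longrightarrow>
        G_homotopy_inverses G (VR_infty \<epsilon>) (pushforward \<alpha>) euclidean \<alpha> (p \<epsilon>) (\<lambda>x. return borel x)"
      "\<And>\<epsilon> \<epsilon>'. 0 < \<epsilon> \<Longrightarrow> \<epsilon> \<le> \<epsilon>' \<Longrightarrow> \<epsilon>' \<le> rX \<Longrightarrow>
        G_homotopic G (VR_infty \<epsilon>) (pushforward \<alpha>) euclidean \<alpha> (p \<epsilon>') (p \<epsilon>)"
    using assms(2) unfolding class_H_def by auto
  obtain q where q: "\<And>\<epsilon>. 0 < \<epsilon> \<Longrightarrow> \<epsilon> \<le> rY \<Longrightarrow>
        G_homotopy_inverses G (VR_infty \<epsilon>) (pushforward \<beta>) euclidean \<beta> (q \<epsilon>) (\<lambda>x. return borel x)"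
      "\<And>\<epsilon> \<epsilon>'. 0 < \<epsilon> \<Longrightarrow> \<epsilon> \<le> \<epsilon>' \<Longrightarrow> \<epsilon>' \<le> rY \<Longrightarrow>
        G_homotopic G (VR_infty \<epsilon>) (pushforward \<beta>) euclidean \<beta> (q \<epsilon>') (q \<epsilon>)"
    using assms(3) unfolding class_H_def by auto
  obtain \<delta> \<Phi> \<Psi> where \<delta>: "0 \<le> \<delta>" "\<delta> < min rX rY / 2"
    and \<Phi>: "G_delta_map G \<delta> (weak_topology :: 'a measure topology) (pushforward \<alpha>) diam_infty
        (weak_topology :: 'b measure topology) (pushforward \<beta>) diam_infty \<Phi>"
    and \<Psi>: "G_delta_map G \<delta> weak_topology (pushforward \<beta>) diam_infty
        weak_topology (pushforward \<alpha>) diam_infty \<Psi>"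
    and \<Psi>\<Phi>: "G_delta_homotopic G (2 * \<delta>) weak_topology (pushforward \<alpha>) diam_infty
        weak_topology (pushforward \<alpha>) diam_infty (\<Psi> \<circ> \<Phi>) id"
    and \<Phi>\<Psi>: "G_delta_homotopic G (2 * \<delta>) weak_topology (pushforward \<beta>) diam_infty
        weak_topology (pushforward \<beta>) diam_infty (\<Phi> \<circ> \<Psi>) id"
    using assms(4) unfolding d_HT_def Inf_less_iff G_delta_homotopy_equivalent_def by auto
  \<comment> \<open>The largest base scale whose \<open>2\<delta>\<close>-enlargement is still covered by both collapses.\<close>
  define \<epsilon> where "\<epsilon> = min rX rY - 2 * \<delta>"
  have \<epsilon>: "0 < \<epsilon>" "\<epsilon> + 2 * \<delta> \<le> rX" "\<epsilon> + 2 * \<delta> \<le> rY"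
    using \<delta>(2) by (auto simp: \<epsilon>_def)
  have jX: "G_map G euclidean \<alpha> (VR_infty \<epsilon>) (pushforward \<alpha>) (\<lambda>x. return borel x)"
    and jY: "G_map G euclidean \<beta> (VR_infty \<epsilon>) (pushforward \<beta>) (\<lambda>x. return borel x)"
    using p(1)[of \<epsilon>] q(1)[of \<epsilon>] \<epsilon> \<delta>(1) by (auto simp: G_homotopy_inverses_def)
  let ?f = "q (\<epsilon> + \<delta>) \<circ> \<Phi> \<circ> (\<lambda>x. return borel x)"
  let ?g = "p (\<epsilon> + \<delta>) \<circ> \<Psi> \<circ> (\<lambda>x. return borel x)"
  have pm: "G_map G (VR_infty (\<epsilon> + \<delta>)) (pushforward \<alpha>) euclidean \<alpha> (p (\<epsilon> + \<delta>))"
    and qm: "G_map G (VR_infty (\<epsilon> + \<delta>)) (pushforward \<beta>) euclidean \<beta> (q (\<epsilon> + \<delta>))"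
    using p(1)[of "\<epsilon> + \<delta>"] q(1)[of "\<epsilon> + \<delta>"] \<epsilon> \<delta>(1) by (auto simp: G_homotopy_inverses_def)
  have "G_map G euclidean \<alpha> euclidean \<beta> ?f"
    using G_map_compose[OF jX G_map_compose[OF G_delta_map_VR_infty[OF \<Phi>] qm]] by simp
  moreover have "G_map G euclidean \<beta> euclidean \<alpha> ?g"
    using G_map_compose[OF jY G_map_compose[OF G_delta_map_VR_infty[OF \<Psi>] pm]] by simp
  moreover have "G_homotopic G euclidean \<alpha> euclidean \<alpha> (?g \<circ> ?f) id"
    using \<epsilon> \<delta>(1) by (intro collapsed_roundtrip_homotopic_id[OF \<Phi> \<Psi> \<Psi>\<Phi> \<epsilon>(1) jX jY
        q(1) p(1) p(2)]) auto
  moreover have "G_homotopic G euclidean \<beta> euclidean \<beta> (?f \<circ> ?g) id"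
    using \<epsilon> \<delta>(1) by (intro collapsed_roundtrip_homotopic_id[OF \<Psi> \<Phi> \<Phi>\<Psi> \<epsilon>(1) jY jX
        p(1) q(1) q(2)]) auto
  ultimately show ?thesis
    unfolding G_homotopy_equivalent_def G_homotopy_inverses_def by blast
qed

end
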